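(* Let $X$ be a geodesic metric space. The following three conditions are equivalent: (1) for every $C > 0$ there exists a real number $C'$ such that, if $A, B \subseteq X$ are $(1, C)$-quasigeodesic subspaces and $A \cap B \neq \varnothing$, then $A \cup B$ is a $(1, C')$-quasigeodesic subspace; (2) for every $\lambda, C > 0$ there exist $\lambda', C' > 0$ such that, if $A, B \subseteq X$ are $(\lambda, C)$-quasigeodesic subspaces and $A \cap B \neq \varnothing$, then $A \cup B$ is a $(\lambda', C')$-quasigeodesic subspace; (3) $X$ is $\delta$-hyperbolic for some $\delta \geq 0$.
   Context: A metric space $(X,d)$ is geodesic if any two of its points are joined by a geodesic, i.e. an isometric embedding of a compact interval of the real line with these points as the images of its endpoints (a geodesic is also identified with its image). A geodesic metric space $X$ is $\delta$-hyperbolic (in the sense of Gromov) if for any three points $a, b, c \in X$ and any geodesics $[a,b]$, $[b,c]$, $[a,c]$ between them, $[b,c]$ is contained in the $\delta$-neighbourhood of $[a,b] \cup [a,c]$, i.e. every point of $[b,c]$ is at distance at most $\delta$ from $[a,b]\cup[a,c]$. A subset $A \subseteq X$ is a $(\lambda, C)$-quasigeodesic subspace if for every pair of points $a, a' \in A$ there is a (not necessarily continuous) map $f : I \to A$ from an interval $I = [0,v]$ of the real line such that $f(0) = a$, $f(v) = a'$, and for all $x, x' \in I$, $$\lambda^{-1} d(x,x') - C \leq d(f(x), f(x')) \leq \lambda d(x,x') + C,$$ where $d(x,x') = |x - x'|$ for $x, x' \in I$. *)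

theory Defs
  imports "HOL-Analysis.Analysis"
begin

text \<open>
  A metric space is given as a set \<open>X\<close> in a type of class \<open>metric_space\<close>, with the induced
  distance; \<open>X = UNIV\<close> is allowed, so every metric space (even the empty one) is covered.
  Geodesics are identified with their images.
\<close>

definition geodesic_between :: "'a::metric_space set \<Rightarrow> 'a \<Rightarrow> 'a \<Rightarrow> 'a set \<Rightarrow> bool" where
  "geodesic_between X a b S \<longleftrightarrow>
     (\<exists>(s::real) (t::real) g. s \<le> t \<and> g ` {s..t} \<subseteq> X \<and>
        (\<forall>x\<in>{s..t}. \<forall>x'\<in>{s..t}. dist (g x) (g x') = \<bar>x - x'\<bar>) \<and>
        g s = a \<and> g t = b \<and> S = g ` {s..t})"

definition geodesic_metric_space :: "'a::metric_space set \<Rightarrow> bool" where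
  "geodesic_metric_space X \<longleftrightarrow> (\<forall>a\<in>X. \<forall>b\<in>X. \<exists>S. geodesic_between X a b S)"

text \<open>
  The sets \<open>Sab\<close> and \<open>Sac\<close> below are nonempty, so the convention \<open>infdist p {} = 0\<close> plays no role.
\<close>

definition delta_hyperbolic :: "real \<Rightarrow> 'a::metric_space set \<Rightarrow> bool" where
  "delta_hyperbolic \<delta> X \<longleftrightarrow>
     (\<forall>a\<in>X. \<forall>b\<in>X. \<forall>c\<in>X. \<forall>Sab Sbc Sac.
        geodesic_between X a b Sab \<longrightarrow> geodesic_between X b c Sbc \<longrightarrow> geodesic_between X a c Sac \<longrightarrow>
        (\<forall>p\<in>Sbc. infdist p (Sab \<union> Sac) \<le> \<delta>))"

definition quasigeodesic_subspace :: "real \<Rightarrow> real \<Rightarrow> 'a::metric_space set \<Rightarrow> bool" where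
  "quasigeodesic_subspace L C A \<longleftrightarrow>
     (\<forall>a\<in>A. \<forall>a'\<in>A. \<exists>(v::real) f. 0 \<le> v \<and> f ` {0..v} \<subseteq> A \<and> f 0 = a \<and> f v = a' \<and>
        (\<forall>x\<in>{0..v}. \<forall>x'\<in>{0..v}.
           inverse L * \<bar>x - x'\<bar> - C \<le> dist (f x) (f x') \<and>
           dist (f x) (f x') \<le> L * \<bar>x - x'\<bar> + C))"

end

theory Submission
  imports Defs "HOL-Real_Asymp.Real_Asymp"
begin

text \<open>
  All conditions are compared with one consequence of negative curvature: between the ends of a
  geodesic, a discrete path that avoids the ball of radius \<open>R\<close> around a point of the geodesic has
  a number of steps exponential in \<open>R\<close> (\<open>exponential_detours\<close>). It implies that a geodesic stays
  close to any quasigeodesic with the same ends (\<open>geodesic_near_quasigeodesic\<close>), since otherwise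
  the quasigeodesic would provide a detour of linear length.

  From unions to hyperbolicity: apply either condition on unions to two geodesics \<open>[a, b]\<close> and
  \<open>[a, c]\<close>. Their union contains a quasigeodesic from \<open>b\<close> to \<open>c\<close> with uniform constants. If detours
  are exponential, \<open>[b, c]\<close> stays close to this quasigeodesic, hence to the two other sides, and
  triangles are slim (\<open>hyperbolic_if_wedges\<close>). That detours are exponential follows from the same
  property of unions: the quasigeodesic jumps from one geodesic to the other, and not far from \<open>b\<close>
  and \<open>c\<close> if these are close to each other, so geodesics from \<open>a\<close> fellow-travel except for a final
  part whose length is controlled by the distance of their ends (\<open>wedge_fellow_travel\<close>). Joining a
  point \<open>p\<close> of a geodesic to the vertices of a detour around \<open>p\<close> and halving the detour
  repeatedly, one finds that the two halves of the geodesic, starting at \<open>p\<close>, fellow-travel up to a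
  distance from \<open>p\<close> that falls short of \<open>R\<close> only linearly in the number of halvings; but they
  move apart at speed 2 (\<open>exponential_detours_if_wedges\<close>).

  From hyperbolicity to unions: detours are exponential by the usual halving argument for slim
  triangles, which gives the Morse lemma, here in the form that distances along a quasigeodesic are
  almost additive (\<open>quasigeodesic_almost_additive\<close>). For quasigeodesics \<open>f\<close> in \<open>A\<close> from \<open>a\<close> to the
  common point and \<open>g\<close> in \<open>B\<close> from there to \<open>b\<close>, some point of \<open>[a, b]\<close> is close to both; going
  over from \<open>f\<close> to \<open>g\<close> near this point gives a quasigeodesic in \<open>A \<union> B\<close> with the same
  multiplicative constant (\<open>quasigeodesic_join\<close>). As this constant is kept, both conditions on
  unions follow at once; multiplicative constants below 1 may be replaced by 1.
\<close>

section \<open>Parametrised geodesics and quasigeodesics\<close>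

definition geodesic_path :: "'a::metric_space set \<Rightarrow> real \<Rightarrow> (real \<Rightarrow> 'a) \<Rightarrow> bool" where
  "geodesic_path X u g \<longleftrightarrow> 0 \<le> u \<and> g ` {0..u} \<subseteq> X \<and>
     (\<forall>x\<in>{0..u}. \<forall>y\<in>{0..u}. dist (g x) (g y) = \<bar>x - y\<bar>)"

definition quasigeodesic_path ::
  "real \<Rightarrow> real \<Rightarrow> 'a::metric_space set \<Rightarrow> real \<Rightarrow> (real \<Rightarrow> 'a) \<Rightarrow> bool" where
  "quasigeodesic_path L C A v f \<longleftrightarrow> 0 \<le> v \<and> f ` {0..v} \<subseteq> A \<and>
     (\<forall>x\<in>{0..v}. \<forall>y\<in>{0..v}. inverse L * \<bar>x - y\<bar> - C \<le> dist (f x) (f y) \<and>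
        dist (f x) (f y) \<le> L * \<bar>x - y\<bar> + C)"

lemma geodesic_pathD:
  assumes "geodesic_path X u g"
  shows "0 \<le> u" "\<And>x. 0 \<le> x \<Longrightarrow> x \<le> u \<Longrightarrow> g x \<in> X"
    "\<And>x y. 0 \<le> x \<Longrightarrow> x \<le> u \<Longrightarrow> 0 \<le> y \<Longrightarrow> y \<le> u \<Longrightarrow> dist (g x) (g y) = \<bar>x - y\<bar>"
  using assms by (auto simp: geodesic_path_def)

lemma geodesic_path_restrict:
  "geodesic_path X u g \<Longrightarrow> 0 \<le> u' \<Longrightarrow> u' \<le> u \<Longrightarrow> geodesic_path X u' g"
  unfolding geodesic_path_def by (auto simp: image_subset_iff)

lemma geodesic_between_path:
  "geodesic_between X a b S \<longleftrightarrow>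
     (\<exists>u g. geodesic_path X u g \<and> g 0 = a \<and> g u = b \<and> S = g ` {0..u})"
proof
  assume "geodesic_between X a b S"
  then obtain s t g where g: "s \<le> t" "g ` {s..t} \<subseteq> X"
      "\<And>x x'. x \<in> {s..t} \<Longrightarrow> x' \<in> {s..t} \<Longrightarrow> dist (g x) (g x') = \<bar>x - x'\<bar>"
      "g s = a" "g t = b" "S = g ` {s..t}"
    unfolding geodesic_between_def by blast
  have img: "(\<lambda>x. g (s + x)) ` {0..t - s} = g ` {s..t}"
  proof -
    have "(\<lambda>x. s + x) ` {0..t - s} = {s..t}"
      by (simp add: image_add_atLeastAtMost)
    then show ?thesis by (metis image_image)
  qed
  have "geodesic_path X (t - s) (\<lambda>x. g (s + x))"
    unfolding geodesic_path_def using g by (auto simp: image_subset_iff)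
  then show "\<exists>u g. geodesic_path X u g \<and> g 0 = a \<and> g u = b \<and> S = g ` {0..u}"
    using g img by (intro exI[of _ "t - s"] exI[of _ "\<lambda>x. g (s + x)"]) simp
next
  assume "\<exists>u g. geodesic_path X u g \<and> g 0 = a \<and> g u = b \<and> S = g ` {0..u}"
  then obtain u g where "geodesic_path X u g" "g 0 = a" "g u = b" "S = g ` {0..u}"
    by blast
  then show "geodesic_between X a b S"
    unfolding geodesic_between_def geodesic_path_def
    by - (rule exI[of _ 0], rule exI[of _ u], rule exI[of _ g], simp)
qed

lemma geodesic_path_exists:
  assumes "geodesic_metric_space X" "a \<in> X" "b \<in> X"
  obtains g where "geodesic_path X (dist a b) g" "g 0 = a" "g (dist a b) = b"
proof -
  obtain u g where g: "geodesic_path X u g" "g 0 = a" "g u = b"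
    using assms unfolding geodesic_metric_space_def geodesic_between_path by blast
  have "dist (g 0) (g u) = u"
    using geodesic_pathD(1)[OF g(1)] geodesic_pathD(3)[OF g(1), of 0 u] by simp
  with g that show thesis by metis
qed

lemma geodesic_between_commute:
  assumes "geodesic_between X a b S"
  shows "geodesic_between X b a S"
proof -
  obtain u g where g: "geodesic_path X u g" "g 0 = a" "g u = b" "S = g ` {0..u}"
    using assms unfolding geodesic_between_path by blast
  have "(\<lambda>x. u - x) ` {0..u} = {0..u}" by simp
  then have "(\<lambda>x. g (u - x)) ` {0..u} = S" using g(4) by (metis image_image)
  moreover have "geodesic_path X u (\<lambda>x. g (u - x))"
    using geodesic_pathD[OF g(1)] by (auto simp: geodesic_path_def)
  ultimately show ?thesis
    unfolding geodesic_between_path using g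
    by (intro exI[of _ u] exI[of _ "\<lambda>x. g (u - x)"]) auto
qed

lemma geodesic_between_subset: "geodesic_between X a b S \<Longrightarrow> S \<subseteq> X"
  unfolding geodesic_between_def by blast

lemma geodesic_between_endpoints:
  assumes "geodesic_between X a b S"
  shows "a \<in> S" "b \<in> S"
  using assms unfolding geodesic_between_def by force+

lemma geodesic_between_additive:
  assumes "geodesic_between X a b S" "p \<in> S"
  shows "dist a p + dist p b = dist a b"
proof -
  obtain u g where g: "geodesic_path X u g" "g 0 = a" "g u = b" "S = g ` {0..u}"
    using assms unfolding geodesic_between_path by blast
  obtain w where "p = g w" "0 \<le> w" "w \<le> u" using assms(2) g(4) by auto
  then show ?thesis
    using geodesic_pathD(1)[OF g(1)] geodesic_pathD(3)[OF g(1)] by (simp flip: g(2,3))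
qed

lemma geodesic_between_dist_le:
  "geodesic_between X a b S \<Longrightarrow> p \<in> S \<Longrightarrow> dist a p \<le> dist a b"
  using geodesic_between_additive[of X a b S p] zero_le_dist[of p b] by linarith

lemma geodesic_path_subarc:
  assumes "geodesic_path X u g" "0 \<le> s" "s \<le> t" "t \<le> u"
  shows "geodesic_between X (g s) (g t) (g ` {s..t})"
  unfolding geodesic_between_def
proof (rule exI[of _ s], rule exI[of _ t], rule exI[of _ g], intro conjI)
  show "g ` {s..t} \<subseteq> X" using geodesic_pathD(2)[OF assms(1)] assms(2-4) by auto
  show "\<forall>x\<in>{s..t}. \<forall>x'\<in>{s..t}. dist (g x) (g x') = \<bar>x - x'\<bar>"
    using geodesic_pathD(3)[OF assms(1)] assms(2-4) by simp
qed (use assms(3) in simp_all)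

lemma continuous_on_geodesic_path:
  assumes "geodesic_path X u g"
  shows "continuous_on {0..u} g"
  unfolding continuous_on_iff
proof (intro ballI allI impI)
  fix x e :: real assume "x \<in> {0..u}" "0 < e"
  then show "\<exists>d>0. \<forall>x'\<in>{0..u}. dist x' x < d \<longrightarrow> dist (g x') (g x) < e"
    using geodesic_pathD(3)[OF assms] by (intro exI[of _ e]) (auto simp: dist_real_def)
qed

lemma quasigeodesic_pathD:
  assumes "quasigeodesic_path L C A v f"
  shows "0 \<le> v" "\<And>x. 0 \<le> x \<Longrightarrow> x \<le> v \<Longrightarrow> f x \<in> A"
    "\<And>x y. 0 \<le> x \<Longrightarrow> x \<le> v \<Longrightarrow> 0 \<le> y \<Longrightarrow> y \<le> v \<Longrightarrow> inverse L * \<bar>x - y\<bar> - C \<le> dist (f x) (f y)"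
    "\<And>x y. 0 \<le> x \<Longrightarrow> x \<le> v \<Longrightarrow> 0 \<le> y \<Longrightarrow> y \<le> v \<Longrightarrow> dist (f x) (f y) \<le> L * \<bar>x - y\<bar> + C"
  using assms by (auto simp: quasigeodesic_path_def)

lemma quasigeodesic_path_parameter_bound:
  assumes "quasigeodesic_path L C A v f" "0 < L" "0 \<le> x" "x \<le> v" "0 \<le> y" "y \<le> v"
    "dist (f x) (f y) \<le> D"
  shows "\<bar>x - y\<bar> \<le> L * (D + C)"
proof -
  have "inverse L * \<bar>x - y\<bar> \<le> D + C"
    using quasigeodesic_pathD(3)[OF assms(1,3-6)] assms(7) by linarith
  then have "L * (inverse L * \<bar>x - y\<bar>) \<le> L * (D + C)"
    using assms(2) by (intro mult_left_mono) auto
  then show ?thesis using assms(2) by (simp flip: mult.assoc)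
qed

lemma quasigeodesic_path_mono:
  assumes "quasigeodesic_path L C A v f" "0 < L" "L \<le> L'" "C \<le> C'" "A \<subseteq> A'"
  shows "quasigeodesic_path L' C' A' v f"
  unfolding quasigeodesic_path_def
proof (intro conjI ballI)
  show "0 \<le> v" "f ` {0..v} \<subseteq> A'"
    using assms by (auto simp: quasigeodesic_path_def)
next
  fix x y assume xy: "x \<in> {0..v}" "y \<in> {0..v}"
  have "inverse L' * \<bar>x - y\<bar> \<le> inverse L * \<bar>x - y\<bar>"
    using assms(2,3) by (intro mult_right_mono le_imp_inverse_le) auto
  then show "inverse L' * \<bar>x - y\<bar> - C' \<le> dist (f x) (f y)"
    using quasigeodesic_pathD(3)[OF assms(1), of x y] xy assms(4) by auto
  have "L * \<bar>x - y\<bar> \<le> L' * \<bar>x - y\<bar>"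
    using assms(3) by (intro mult_right_mono) auto
  then show "dist (f x) (f y) \<le> L' * \<bar>x - y\<bar> + C'"
    using quasigeodesic_pathD(4)[OF assms(1), of x y] xy assms(4) by auto
qed

lemma quasigeodesic_path_restrict:
  assumes "quasigeodesic_path L C A v f" "0 \<le> s" "s \<le> t" "t \<le> v"
  shows "quasigeodesic_path L C A (t - s) (\<lambda>x. f (s + x))"
  unfolding quasigeodesic_path_def
proof (intro conjI ballI)
  show "0 \<le> t - s" "(\<lambda>x. f (s + x)) ` {0..t - s} \<subseteq> A"
    using assms by (auto simp: quasigeodesic_path_def image_subset_iff)
next
  fix x y assume xy: "x \<in> {0..t - s}" "y \<in> {0..t - s}"
  have "s + x - (s + y) = x - y" by simp
  then show "inverse L * \<bar>x - y\<bar> - C \<le> dist (f (s + x)) (f (s + y))"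
      "dist (f (s + x)) (f (s + y)) \<le> L * \<bar>x - y\<bar> + C"
    using quasigeodesic_pathD(3,4)[OF assms(1), of "s + x" "s + y"] xy assms(2-4) by auto
qed

lemma quasigeodesic_subspace_path:
  "quasigeodesic_subspace L C A \<longleftrightarrow>
     (\<forall>a\<in>A. \<forall>a'\<in>A. \<exists>v f. quasigeodesic_path L C A v f \<and> f 0 = a \<and> f v = a')"
  unfolding quasigeodesic_subspace_def quasigeodesic_path_def by (simp only: conj_assoc) blast

lemma quasigeodesic_subspace_mono:
  assumes "quasigeodesic_subspace L C A" "0 < L" "L \<le> L'" "C \<le> C'"
  shows "quasigeodesic_subspace L' C' A"
  unfolding quasigeodesic_subspace_path
proof (intro ballI)
  fix a a' assume "a \<in> A" "a' \<in> A"
  then obtain v f where "quasigeodesic_path L C A v f" "f 0 = a" "f v = a'"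
    using assms(1) unfolding quasigeodesic_subspace_path by meson
  then show "\<exists>v f. quasigeodesic_path L' C' A v f \<and> f 0 = a \<and> f v = a'"
    using quasigeodesic_path_mono[OF _ assms(2-4) subset_refl] by metis
qed

lemma quasigeodesic_subspace_geodesic:
  assumes "geodesic_path X u g" "0 \<le> C"
  shows "quasigeodesic_subspace 1 C (g ` {0..u})"
  unfolding quasigeodesic_subspace_path
proof (intro ballI)
  fix a a' assume "a \<in> g ` {0..u}" "a' \<in> g ` {0..u}"
  then obtain s t where st: "a = g s" "a' = g t" "s \<in> {0..u}" "t \<in> {0..u}" by blast
  show "\<exists>v f. quasigeodesic_path 1 C (g ` {0..u}) v f \<and> f 0 = a \<and> f v = a'"
  proof (cases "s \<le> t")
    case True
    have "quasigeodesic_path 1 C (g ` {0..u}) (t - s) (\<lambda>x. g (s + x))"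
      unfolding quasigeodesic_path_def
      using True st assms(2) geodesic_pathD(3)[OF assms(1)] by auto
    then show ?thesis
      using st by (intro exI[of _ "t - s"] exI[of _ "\<lambda>x. g (s + x)"]) simp
  next
    case False
    have "quasigeodesic_path 1 C (g ` {0..u}) (s - t) (\<lambda>x. g (s - x))"
      unfolding quasigeodesic_path_def
      using False st assms(2) geodesic_pathD(3)[OF assms(1)] by auto
    then show ?thesis
      using st by (intro exI[of _ "s - t"] exI[of _ "\<lambda>x. g (s - x)"]) simp
  qed
qed

text \<open>
  The points of a geodesic close to \<open>P\<close> and those close to \<open>Q\<close> form two open sets covering it;
  each contains an endpoint, so by connectedness they meet.
\<close>

lemma geodesic_covered_meets_both:
  assumes "geodesic_between X a b S" "a \<in> P" "b \<in> Q"
    and cover: "\<And>r. r \<in> S \<Longrightarrow> \<exists>x\<in>P \<union> Q. dist r x < D"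
  obtains r p q where "r \<in> S" "p \<in> P" "q \<in> Q" "dist r p < D" "dist r q < D"
proof -
  obtain u g where g: "geodesic_path X u g" "g 0 = a" "g u = b" "S = g ` {0..u}"
    using assms unfolding geodesic_between_path by blast
  have S: "connected S"
    unfolding g(4) by (intro connected_continuous_image continuous_on_geodesic_path[OF g(1)]) simp
  have ab: "a \<in> S" "b \<in> S" using geodesic_between_endpoints[OF assms(1)] by auto
  obtain x0 where "dist a x0 < D" using cover[OF ab(1)] by blast
  then have "0 < D" using zero_le_dist[of a x0] by linarith
  define U where "U = (\<Union>p\<in>P. ball p D)"
  define V where "V = (\<Union>q\<in>Q. ball q D)"
  have "open U" "open V" unfolding U_def V_def by auto
  moreover have "S \<subseteq> U \<union> V"
  proof
    fix r assume "r \<in> S"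
    then obtain x where "x \<in> P \<union> Q" "dist r x < D" using cover by blast
    then show "r \<in> U \<union> V" unfolding U_def V_def by (force simp: dist_commute)
  qed
  moreover have "a \<in> U \<inter> S" "b \<in> V \<inter> S"
    using assms(2,3) ab \<open>0 < D\<close> unfolding U_def V_def by (auto intro!: bexI)
  ultimately have "U \<inter> V \<inter> S \<noteq> {}"
    using S unfolding connected_def by blast
  then show thesis using that unfolding U_def V_def by (auto simp: dist_commute)
qed


lemma infdist_lessE:
  assumes "infdist x A < D" "A \<noteq> {}"
  obtains a where "a \<in> A" "dist x a < D"
proof -
  have "bdd_below (dist x ` A)" by (intro bdd_belowI2[of _ 0]) simp
  then show thesis
    using assms that by (auto simp: infdist_notempty cINF_less_iff)
qed


section \<open>Detours around a ball\<close>

text \<open>The relational powers of \<open>step_avoiding X \<sigma> p R\<close> are the discrete paths that avoid the open ball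
  of radius \<open>R\<close> around \<open>p\<close>.\<close>

definition step_avoiding :: "'a::metric_space set \<Rightarrow> real \<Rightarrow> 'a \<Rightarrow> real \<Rightarrow> ('a \<times> 'a) set" where
  "step_avoiding X \<sigma> p R =
     {(x, y). x \<in> X \<and> y \<in> X \<and> dist x y \<le> \<sigma> \<and> R \<le> dist p x \<and> R \<le> dist p y}"

text \<open>
  A detour between the ends of a geodesic around the ball of radius \<open>R\<close> at one of its points needs
  a number of steps exponential in \<open>R\<close>. This is the form in which negative curvature enters the
  whole proof. Only the powers \<open>2 ^ k\<close> are counted because the inductions halve the detour;
  shorter ones are padded with trivial steps.
\<close>

definition exponential_detours :: "'a::metric_space set \<Rightarrow> bool" where
  "exponential_detours X \<longleftrightarrow> (\<forall>\<sigma>\<ge>0. \<exists>M>0. \<forall>k R b c S p.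
     geodesic_between X b c S \<longrightarrow> p \<in> S \<longrightarrow> (b, c) \<in> step_avoiding X \<sigma> p R ^^ (2 ^ k) \<longrightarrow>
     R \<le> M * (real k + 1))"

lemma sym_step_avoiding: "sym (step_avoiding X \<sigma> p R)"
  by (auto simp: step_avoiding_def sym_def dist_commute)

lemma sym_relpow: "sym r \<Longrightarrow> sym (r ^^ n)"
proof (induction n)
  case (Suc n)
  then show ?case
    by (metis converse_relcomp relpow.simps(2) relpow_commute sym_conv_converse_eq)
qed (auto simp: sym_def)

lemma relpow_pad:
  assumes "(x, y) \<in> r ^^ n" "n \<le> m" "(y, y) \<in> r"
  shows "(x, y) \<in> r ^^ m"
  using assms(2,1)
proof (induction m rule: dec_induct)
  case (step m)
  then show ?case using assms(3) by auto
qed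

lemma relpow_step_avoiding_ends:
  assumes "(x, y) \<in> step_avoiding X \<sigma> p R ^^ n" "0 < n"
  shows "x \<in> X \<and> y \<in> X \<and> R \<le> dist p x \<and> R \<le> dist p y"
proof -
  obtain m where "n = Suc m" using assms(2) gr0_conv_Suc by blast
  with assms(1) have "(x, y) \<in> step_avoiding X \<sigma> p R O step_avoiding X \<sigma> p R ^^ m"
      "(x, y) \<in> step_avoiding X \<sigma> p R ^^ m O step_avoiding X \<sigma> p R"
    by (simp_all add: relpow_commute)
  then show ?thesis by (auto simp: step_avoiding_def)
qed

lemma relpow_double_stepE:
  assumes "(b, c) \<in> r ^^ (2 ^ Suc k)"
  obtains m where "(b, m) \<in> r ^^ (2 ^ k)" "(m, c) \<in> r ^^ (2 ^ k)"
proof -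
  have "(2::nat) ^ Suc k = 2 ^ k + 2 ^ k" by simp
  then have "(b, c) \<in> r ^^ (2 ^ k) O r ^^ (2 ^ k)"
    using assms relpow_add by metis
  then show thesis using that by blast
qed

lemma relpow_along_path:
  fixes s t :: real
  assumes step: "\<And>x y. x \<in> {min s t..max s t} \<Longrightarrow> y \<in> {min s t..max s t} \<Longrightarrow> \<bar>x - y\<bar> \<le> 1 \<Longrightarrow>
    (h x, h y) \<in> r"
  shows "(h s, h t) \<in> r ^^ nat \<lceil>\<bar>s - t\<bar>\<rceil>"
proof (cases "s = t")
  case False
  define n where "n = nat \<lceil>\<bar>s - t\<bar>\<rceil>"
  have n: "0 < n" "\<bar>s - t\<bar> \<le> real n"
    using False unfolding n_def by (auto simp: le_of_int_ceiling)
  define z where "z i = s + (t - s) * (real i / real n)" for i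
  have mem: "z i \<in> {min s t..max s t}" if "i \<le> n" for i
  proof -
    define q where "q = real i / real n"
    have q: "0 \<le> q" "q \<le> 1" unfolding q_def using that n by auto
    have "z i = (1 - q) *\<^sub>R s + q *\<^sub>R t"
      unfolding z_def q_def[symmetric] by (simp add: algebra_simps)
    then have "z i \<in> closed_segment s t"
      using q unfolding closed_segment_def by blast
    then show ?thesis by (auto simp: closed_segment_eq_real_ivl split: if_splits)
  qed
  have "(h (z i), h (z (Suc i))) \<in> r" if "i < n" for i
  proof (rule step)
    have "z i - z (Suc i) = (s - t) / real n"
      unfolding z_def using n by (simp add: field_simps)
    then have "\<bar>z i - z (Suc i)\<bar> = \<bar>s - t\<bar> / real n" by (simp only: abs_divide abs_of_nat)
    also have "\<dots> \<le> 1" using n by (simp only: divide_le_eq_1_pos of_nat_0_less_iff)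
    finally show "\<bar>z i - z (Suc i)\<bar> \<le> 1" .
    show "z i \<in> {min s t..max s t}" using mem[of i] that by linarith
    show "z (Suc i) \<in> {min s t..max s t}" using mem[of "Suc i"] that by linarith
  qed
  moreover have "z 0 = s" "z n = t" using n by (auto simp: z_def)
  ultimately have "(h s, h t) \<in> r ^^ n"
    unfolding relpow_fun_conv by (intro exI[of _ "\<lambda>i. h (z i)"]) auto
  then show ?thesis unfolding n_def .
qed simp

text \<open>Slim triangles halve a detour: each halving moves a point of the geodesic by at most
  \<open>\<delta> + 1\<close> to a geodesic spanning half as many steps.\<close>

lemma exponential_detours_if_hyperbolic:
  assumes X: "geodesic_metric_space X" and hyp: "delta_hyperbolic \<delta> X" and "0 \<le> \<delta>"
  shows "exponential_detours X"
  unfolding exponential_detours_def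
proof (intro allI impI)
  fix \<sigma> :: real assume "0 \<le> \<sigma>"
  have far: "R - \<sigma> - real k * (\<delta> + 1) \<le> dist p q"
    if "geodesic_between X b c S" "q \<in> S" "(b, c) \<in> step_avoiding X \<sigma> p R ^^ (2 ^ k)"
    for k R b c S p q
    using that
  proof (induction k arbitrary: b c S q)
    case 0
    then have "dist b c \<le> \<sigma>" "R \<le> dist p b" by (auto simp: step_avoiding_def)
    moreover have "dist b q \<le> dist b c" using geodesic_between_dist_le 0 by blast
    ultimately show ?case using dist_triangle2[of p b q] by simp
  next
    case (Suc k)
    obtain m where m: "(b, m) \<in> step_avoiding X \<sigma> p R ^^ (2 ^ k)"
        "(m, c) \<in> step_avoiding X \<sigma> p R ^^ (2 ^ k)"
      using Suc.prems(3) by (rule relpow_double_stepE)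
    have X3: "b \<in> X" "m \<in> X" "c \<in> X"
      using relpow_step_avoiding_ends[OF m(1)] relpow_step_avoiding_ends[OF m(2)] by auto
    obtain T T' where T: "geodesic_between X m b T" "geodesic_between X m c T'"
      using X X3 unfolding geodesic_metric_space_def by meson
    have "infdist q (T \<union> T') \<le> \<delta>"
      using hyp X3 T Suc.prems(1,2) unfolding delta_hyperbolic_def by blast
    moreover have "T \<union> T' \<noteq> {}" using geodesic_between_endpoints[OF T(1)] by blast
    ultimately obtain q' where q': "q' \<in> T \<union> T'" "dist q q' < \<delta> + 1"
      using infdist_lessE[of q "T \<union> T'" "\<delta> + 1"] by auto
    have "(m, b) \<in> step_avoiding X \<sigma> p R ^^ (2 ^ k)"
      using m(1) sym_relpow[OF sym_step_avoiding] by (metis symD)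
    then have "R - \<sigma> - real k * (\<delta> + 1) \<le> dist p q'"
      using Suc.IH T m(2) q'(1) by blast
    then show ?case
      using dist_triangle[of p q' q] q'(2) by (simp add: algebra_simps)
  qed
  show "\<exists>M>0. \<forall>k R b c S p. geodesic_between X b c S \<longrightarrow> p \<in> S \<longrightarrow>
      (b, c) \<in> step_avoiding X \<sigma> p R ^^ (2 ^ k) \<longrightarrow> R \<le> M * (real k + 1)"
  proof (intro exI[of _ "\<sigma> + \<delta> + 1"] conjI allI impI)
    show "0 < \<sigma> + \<delta> + 1" using \<open>0 \<le> \<sigma>\<close> \<open>0 \<le> \<delta>\<close> by simp
    fix k R b c S p
    assume "geodesic_between X b c S" "p \<in> S" "(b, c) \<in> step_avoiding X \<sigma> p R ^^ (2 ^ k)"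
    then have "R \<le> \<sigma> + real k * (\<delta> + 1)" using far by fastforce
    also have "\<dots> \<le> (\<sigma> + \<delta> + 1) * (real k + 1)"
      using \<open>0 \<le> \<sigma>\<close> \<open>0 \<le> \<delta>\<close> by (simp add: algebra_simps)
    finally show "R \<le> (\<sigma> + \<delta> + 1) * (real k + 1)" .
  qed
qed


section \<open>Exponential detours and quasigeodesics\<close>

lemma linear_below_exponential:
  fixes \<alpha> \<beta> M :: real
  assumes "0 < \<alpha>" "0 < \<beta>" "0 < M"
  obtains D0 where "0 < D0" "\<And>D. D0 \<le> D \<Longrightarrow> \<exists>k. \<alpha> * D + \<beta> \<le> 2 ^ k \<and> M * (real k + 1) < D - 1"
proof -
  have "eventually (\<lambda>D. \<alpha> * D + \<beta> \<le> 2 powr ((D - 1) / M - 3)) at_top"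
    using assms by real_asymp
  moreover have "eventually (\<lambda>D. 3 * M + 1 \<le> D \<and> 0 < D) at_top"
    by (intro eventually_conj eventually_ge_at_top eventually_gt_at_top)
  ultimately have "eventually (\<lambda>D. \<alpha> * D + \<beta> \<le> 2 powr ((D - 1) / M - 3) \<and>
      3 * M + 1 \<le> D \<and> 0 < D) at_top"
    by eventually_elim simp
  then obtain D0 where D0: "\<And>D. D0 \<le> D \<Longrightarrow>
      \<alpha> * D + \<beta> \<le> 2 powr ((D - 1) / M - 3) \<and> 3 * M + 1 \<le> D \<and> 0 < D"
    unfolding eventually_at_top_linorder by blast
  have "\<exists>k. \<alpha> * D + \<beta> \<le> 2 ^ k \<and> M * (real k + 1) < D - 1" if "D0 \<le> D" for D
  proof -
    define w where "w = (D - 1) / M"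
    \<comment> \<open>The 2 makes \<open>k + 1 < w\<close>; rounding costs one more, hence the 3 in the exponent above.\<close>
    define k where "k = nat \<lfloor>w - 2\<rfloor>"
    have w: "3 \<le> w" "M * w = D - 1"
      using D0[OF that] assms unfolding w_def by (auto simp: field_simps)
    have k: "real k \<le> w - 2" "w - 3 \<le> real k" unfolding k_def using w by linarith+
    have "2 powr (w - 3) \<le> 2 powr real k" using k by simp
    also have "\<dots> = 2 ^ k" by (simp add: powr_realpow)
    finally have "\<alpha> * D + \<beta> \<le> 2 ^ k" using D0[OF that] unfolding w_def by linarith
    moreover have "M * (real k + 1) < M * w"
      using k assms by (intro mult_strict_left_mono) auto
    ultimately show ?thesis using w by auto
  qed
  then show thesis using that D0 by blast
qed

lemma relpow_step_avoiding_geodesic: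
  assumes X: "geodesic_metric_space X" and "x \<in> X" "y \<in> X" "1 \<le> \<sigma>" "R + dist x y \<le> dist p x"
  shows "(x, y) \<in> step_avoiding X \<sigma> p R ^^ nat \<lceil>dist x y\<rceil>"
proof -
  obtain g where g: "geodesic_path X (dist x y) g" "g 0 = x" "g (dist x y) = y"
    using geodesic_path_exists[OF X assms(2,3)] by blast
  note gD = geodesic_pathD[OF g(1)]
  have away: "R \<le> dist p (g z)" if "z \<in> {0..dist x y}" for z
  proof -
    have "dist x (g z) \<le> dist x y" using gD(3)[of 0 z] that g(2) by auto
    then show ?thesis using dist_triangle2[of p x "g z"] assms(5) by linarith
  qed
  have "(g 0, g (dist x y)) \<in> step_avoiding X \<sigma> p R ^^ nat \<lceil>\<bar>0 - dist x y\<bar>\<rceil>"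
  proof (rule relpow_along_path)
    fix a b :: real
    assume "a \<in> {min 0 (dist x y)..max 0 (dist x y)}" "b \<in> {min 0 (dist x y)..max 0 (dist x y)}"
      "\<bar>a - b\<bar> \<le> 1"
    then show "(g a, g b) \<in> step_avoiding X \<sigma> p R"
      using gD away assms(4) by (auto simp: step_avoiding_def)
  qed
  then show ?thesis using g by simp
qed

text \<open>
  Half of the Morse lemma. At a point \<open>p\<close> of the geodesic whose distance \<open>D\<close> to the quasigeodesic
  is maximal, leave the geodesic at distance \<open>2 * D\<close> on either side of \<open>p\<close>, go to the
  quasigeodesic and follow it. This detour avoids a ball of radius about \<open>D\<close> around \<open>p\<close> in a number
  of steps linear in \<open>D\<close>, so \<open>D\<close> is bounded.
\<close>

lemma geodesic_near_quasigeodesic: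
  fixes X :: "'a::metric_space set"
  assumes X: "geodesic_metric_space X" and detours: "exponential_detours X"
    and L: "1 \<le> L" and C: "0 \<le> C"
  obtains D0 where "0 < D0" "\<And>v f S p. quasigeodesic_path L C X v f \<Longrightarrow>
    geodesic_between X (f 0) (f v) S \<Longrightarrow> p \<in> S \<Longrightarrow> \<exists>x\<in>{0..v}. dist p (f x) < D0"
proof -
  define \<sigma> where "\<sigma> = L + C"
  have \<sigma>: "1 \<le> \<sigma>" using L C by (simp add: \<sigma>_def)
  obtain M where M: "0 < M" "\<And>k R b c S p. geodesic_between X b c S \<Longrightarrow> p \<in> S \<Longrightarrow>
      (b, c) \<in> step_avoiding X \<sigma> p R ^^ (2 ^ k) \<Longrightarrow> R \<le> M * (real k + 1)"
    using detours \<sigma> unfolding exponential_detours_def by (meson order_trans zero_le_one)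
  \<comment> \<open>The detour has at most \<open>D + 2\<close> steps on either geodesic part and at most
    \<open>L * (6 * D + 2 + C) + 1\<close> on the quasigeodesic.\<close>
  define \<alpha> where "\<alpha> = 2 + 6 * L"
  define \<beta> where "\<beta> = 5 + L * (2 + C)"
  have "0 < \<alpha>" "0 < \<beta>" using L C by (auto simp: \<alpha>_def \<beta>_def intro: add_pos_nonneg)
  then obtain D0 where D0: "0 < D0"
      "\<And>D. D0 \<le> D \<Longrightarrow> \<exists>k. \<alpha> * D + \<beta> \<le> 2 ^ k \<and> M * (real k + 1) < D - 1"
    using linear_below_exponential[OF _ _ M(1)] by blast
  have "\<exists>x\<in>{0..v}. dist q (f x) < D0"
    if f: "quasigeodesic_path L C X v f" and S: "geodesic_between X (f 0) (f v) S" and "q \<in> S"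
    for v f S q
  proof -
    note fD = quasigeodesic_pathD[OF f]
    define F where "F = f ` {0..v}"
    have F: "F \<noteq> {}" using fD(1) by (auto simp: F_def)
    obtain u g where g: "geodesic_path X u g" "g 0 = f 0" "g u = f v" "S = g ` {0..u}"
      using S unfolding geodesic_between_path by blast
    note gD = geodesic_pathD[OF g(1)]
    have "compact S"
      unfolding g(4) by (intro compact_continuous_image continuous_on_geodesic_path[OF g(1)]) simp
    moreover have "S \<noteq> {}" using \<open>q \<in> S\<close> by blast
    moreover have "continuous_on S (\<lambda>y. infdist y F)"
      by (intro continuous_on_infdist continuous_on_id)
    ultimately have "\<exists>p\<in>S. \<forall>y\<in>S. infdist y F \<le> infdist p F"
      by (rule continuous_attains_sup)
    then obtain p where p: "p \<in> S" "\<And>y. y \<in> S \<Longrightarrow> infdist y F \<le> infdist p F" by blast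
    define D where "D = infdist p F"
    have "0 \<le> D" by (simp add: D_def infdist_nonneg)
    have "D < D0"
    proof (rule ccontr)
      assume "\<not> D < D0"
      then obtain k where k: "\<alpha> * D + \<beta> \<le> 2 ^ k" "M * (real k + 1) < D - 1"
        using D0(2)[of D] by auto
      define r where "r = step_avoiding X \<sigma> p (D - 1)"
      have r_sym: "(y, z) \<in> r ^^ n \<Longrightarrow> (z, y) \<in> r ^^ n" for y z n
        using sym_relpow[OF sym_step_avoiding] unfolding r_def by (metis symD)
      obtain w where w: "0 \<le> w" "w \<le> u" "p = g w" using p(1) g(4) by auto
      have F_far: "D \<le> dist p (f x)" if "0 \<le> x" "x \<le> v" for x
        unfolding D_def using that by (intro infdist_le) (auto simp: F_def)
      have to_F: "\<exists>s n. s \<in> {0..v} \<and> (g y, f s) \<in> r ^^ n \<and> real n \<le> D + 2 \<and> dist (g y) (f s) \<le> D + 1"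
        if y: "0 \<le> y" "y \<le> u" and cases: "y = 0 \<or> y = u \<or> \<bar>w - y\<bar> = 2 * D" for y
      proof (cases "y = 0 \<or> y = u")
        case True
        then obtain s where "s \<in> {0..v}" "g y = f s" using g fD(1) by auto
        then show ?thesis using \<open>0 \<le> D\<close> by (intro exI[of _ s] exI[of _ 0]) auto
      next
        case False
        have "g y \<in> S" using y g(4) by auto
        then have "infdist (g y) F < D + 1" using p(2) unfolding D_def by force
        then obtain s where s: "s \<in> {0..v}" "dist (g y) (f s) < D + 1"
          using infdist_lessE[OF _ F] unfolding F_def by blast
        have "dist p (g y) = 2 * D" using False cases gD(3)[of w y] w y by simp
        then have "(g y, f s) \<in> r ^^ nat \<lceil>dist (g y) (f s)\<rceil>"
          unfolding r_def using s fD(2) gD(2) y \<sigma>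
          by (intro relpow_step_avoiding_geodesic[OF X]) auto
        moreover have "real (nat \<lceil>dist (g y) (f s)\<rceil>) \<le> D + 2"
          using s(2) zero_le_dist[of "g y" "f s"] by linarith
        ultimately show ?thesis using s by (meson less_imp_le)
      qed
      define y where "y = max 0 (w - 2 * D)"
      define z where "z = min u (w + 2 * D)"
      have yz: "0 \<le> y" "y \<le> w" "w \<le> z" "z \<le> u" "z - y \<le> 4 * D"
        using w \<open>0 \<le> D\<close> by (auto simp: y_def z_def)
      obtain s n1 where s: "s \<in> {0..v}" "(g y, f s) \<in> r ^^ n1" "real n1 \<le> D + 2"
          "dist (g y) (f s) \<le> D + 1"
        using to_F[of y] yz w \<open>0 \<le> D\<close> by (auto simp: y_def max_def split: if_splits)
      obtain t n3 where t: "t \<in> {0..v}" "(g z, f t) \<in> r ^^ n3" "real n3 \<le> D + 2"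
          "dist (g z) (f t) \<le> D + 1"
        using to_F[of z] yz w \<open>0 \<le> D\<close> by (auto simp: z_def min_def split: if_splits)
      have "dist (g y) (g z) \<le> 4 * D" using gD(3)[of y z] yz w by simp
      then have "dist (f s) (f t) \<le> 6 * D + 2"
        using s(4) t(4) dist_triangle[of "f s" "f t" "g y"] dist_triangle[of "g y" "f t" "g z"]
        by (simp add: dist_commute)
      then have st: "\<bar>s - t\<bar> \<le> L * (6 * D + 2 + C)"
        using quasigeodesic_path_parameter_bound[OF f] s(1) t(1) L by simp
      define n2 where "n2 = nat \<lceil>\<bar>s - t\<bar>\<rceil>"
      have n2: "real n2 \<le> L * (6 * D + 2 + C) + 1" unfolding n2_def using st by linarith
      have "(f s, f t) \<in> r ^^ n2"
        unfolding n2_def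
      proof (rule relpow_along_path)
        fix x x' :: real
        assume "x \<in> {min s t..max s t}" "x' \<in> {min s t..max s t}" and xx': "\<bar>x - x'\<bar> \<le> 1"
        then have v: "0 \<le> x" "x \<le> v" "0 \<le> x'" "x' \<le> v" using s(1) t(1) by auto
        have "L * \<bar>x - x'\<bar> \<le> L * 1" using L xx' by (intro mult_left_mono) auto
        then have "dist (f x) (f x') \<le> \<sigma>" using fD(4)[OF v] by (simp add: \<sigma>_def)
        then show "(f x, f x') \<in> r"
          using F_far[of x] F_far[of x'] v fD(2) by (auto simp: r_def step_avoiding_def)
      qed
      then have "(g y, g z) \<in> r ^^ (n1 + n2 + n3)"
        using s(2) r_sym[OF t(2)] unfolding relpow_add by blast
      moreover have "n1 + n2 + n3 \<le> 2 ^ k"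
      proof -
        have "real (n1 + n2 + n3) \<le> \<alpha> * D + \<beta>"
          using s(3) t(3) n2 unfolding \<alpha>_def \<beta>_def by (simp add: algebra_simps)
        then have "real (n1 + n2 + n3) \<le> real (2 ^ k)" using k(1) by simp
        then show ?thesis by (simp only: of_nat_le_iff)
      qed
      moreover have "(g z, g z) \<in> r"
      proof -
        have "D - 1 \<le> dist p (g z)"
        proof (cases "z = u")
          case True
          then show ?thesis using F_far[of v] fD(1) g(3) by simp
        next
          case False
          then have "z = w + 2 * D" by (auto simp: z_def min_def split: if_splits)
          then show ?thesis using gD(3)[of w z] w yz \<open>0 \<le> D\<close> by simp
        qed
        then show ?thesis
          using gD(2)[of z] yz w \<sigma> by (auto simp: r_def step_avoiding_def)
      qed
      ultimately have "(g y, g z) \<in> step_avoiding X \<sigma> p (D - 1) ^^ (2 ^ k)"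
        unfolding r_def by (rule relpow_pad)
      moreover have "geodesic_between X (g y) (g z) (g ` {y..z})"
        using geodesic_path_subarc[OF g(1)] yz by simp
      moreover have "p \<in> g ` {y..z}" using yz w by auto
      ultimately have "D - 1 \<le> M * (real k + 1)" using M(2) by blast
      then show False using k(2) by simp
    qed
    then have "infdist q F < D0" using p(2)[OF \<open>q \<in> S\<close>] unfolding D_def by linarith
    then show ?thesis using infdist_lessE[OF _ F] unfolding F_def by blast
  qed
  then show thesis using that D0(1) by blast
qed

text \<open>
  The other half of the Morse lemma, as a reversed triangle inequality. The two pieces of a
  quasigeodesic before and after the parameter \<open>x\<close> both come close to one point of the geodesic;
  the parameters at which they do so are then close to each other and enclose \<open>x\<close>, so \<open>f x\<close> is
  close to the geodesic as well.
\<close>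

lemma quasigeodesic_almost_additive:
  fixes X :: "'a::metric_space set"
  assumes X: "geodesic_metric_space X" and detours: "exponential_detours X"
    and L: "1 \<le> L" and C: "0 \<le> C"
  obtains E where "0 \<le> E" "\<And>v f x. quasigeodesic_path L C X v f \<Longrightarrow> 0 \<le> x \<Longrightarrow> x \<le> v \<Longrightarrow>
    dist (f 0) (f x) + dist (f x) (f v) \<le> dist (f 0) (f v) + E"
proof -
  obtain D where D: "0 < D" "\<And>v f S p. quasigeodesic_path L C X v f \<Longrightarrow>
    geodesic_between X (f 0) (f v) S \<Longrightarrow> p \<in> S \<Longrightarrow> \<exists>x\<in>{0..v}. dist p (f x) < D"
    using geodesic_near_quasigeodesic[OF assms] by blast
  define N where "N = L * (L * (2 * D + C)) + C + D"
  have "dist (f 0) (f x) + dist (f x) (f v) \<le> dist (f 0) (f v) + 2 * N"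
    if f: "quasigeodesic_path L C X v f" and x: "0 \<le> x" "x \<le> v" for v f x
  proof -
    note fD = quasigeodesic_pathD[OF f]
    obtain S where S: "geodesic_between X (f 0) (f v) S"
      using X fD(1,2) unfolding geodesic_metric_space_def by blast
    have "\<exists>y\<in>f ` {0..x} \<union> f ` {x..v}. dist r y < D" if "r \<in> S" for r
    proof -
      have "{0..v} = {0..x} \<union> {x..v}" using x by auto
      then show ?thesis using D(2)[OF f S that] by blast
    qed
    moreover have "f 0 \<in> f ` {0..x}" "f v \<in> f ` {x..v}" using x by auto
    ultimately obtain r y z where r: "r \<in> S" "y \<in> f ` {0..x}" "z \<in> f ` {x..v}"
        "dist r y < D" "dist r z < D"
      using geodesic_covered_meets_both[OF S, of "f ` {0..x}" "f ` {x..v}" D] by metis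
    then obtain s t where st: "0 \<le> s" "s \<le> x" "x \<le> t" "t \<le> v"
        "dist r (f s) < D" "dist r (f t) < D" by auto
    have "dist (f s) (f t) \<le> 2 * D"
      using st(5,6) dist_triangle3[of "f s" "f t" r] by simp
    then have "\<bar>s - t\<bar> \<le> L * (2 * D + C)"
      using quasigeodesic_path_parameter_bound[OF f, of s t "2 * D"] st L by linarith
    then have "\<bar>s - x\<bar> \<le> L * (2 * D + C)" using st by linarith
    then have "L * \<bar>s - x\<bar> \<le> L * (L * (2 * D + C))"
      using L by (intro mult_left_mono) auto
    then have "dist (f s) (f x) \<le> L * (L * (2 * D + C)) + C"
      using fD(4)[of s x] st x by linarith
    then have "dist r (f x) \<le> N"
      using st(5) dist_triangle[of r "f x" "f s"] unfolding N_def by linarith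
    moreover have "dist (f 0) r + dist r (f v) = dist (f 0) (f v)"
      using geodesic_between_additive[OF S r(1)] .
    ultimately show ?thesis
      using dist_triangle[of "f 0" "f x" r] dist_triangle3[of "f x" "f v" r] by linarith
  qed
  moreover have "0 \<le> 2 * N" using L C D(1) by (simp add: N_def)
  ultimately show thesis using that by blast
qed

text \<open>
  A geodesic \<open>[a, b]\<close> with \<open>a \<in> A\<close> and \<open>b \<in> B\<close> stays close to the quasigeodesics \<open>f\<close> and \<open>g\<close>
  from \<open>a\<close> and \<open>b\<close> to the common point, hence is at one point \<open>r\<close> close to both, say to \<open>f s\<close> and
  \<open>g t\<close>. Follow \<open>f\<close> up to \<open>f s\<close>, jump to \<open>g t\<close> and follow \<open>g\<close>. Both pieces are almost additive and
  \<open>r\<close> lies on \<open>[a, b]\<close>, so points on different pieces are almost as far apart as along the path.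
\<close>

lemma quasigeodesic_join:
  fixes X :: "'a::metric_space set"
  assumes X: "geodesic_metric_space X" and hyp: "delta_hyperbolic \<delta> X" and "0 \<le> \<delta>"
    and L: "1 \<le> L" and C: "0 \<le> C"
  obtains C' where "C \<le> C'" "\<And>v f v' g A B. A \<subseteq> X \<Longrightarrow> B \<subseteq> X \<Longrightarrow>
    quasigeodesic_path L C A v f \<Longrightarrow> quasigeodesic_path L C B v' g \<Longrightarrow> f v = g 0 \<Longrightarrow>
    \<exists>w h. quasigeodesic_path L C' (A \<union> B) w h \<and> h 0 = f 0 \<and> h w = g v'"
proof -
  have detours: "exponential_detours X"
    using exponential_detours_if_hyperbolic[OF X hyp \<open>0 \<le> \<delta>\<close>] .
  obtain D where D: "0 < D" "\<And>v f S p. quasigeodesic_path L C X v f \<Longrightarrow>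
      geodesic_between X (f 0) (f v) S \<Longrightarrow> p \<in> S \<Longrightarrow> \<exists>x\<in>{0..v}. dist p (f x) < D"
    using geodesic_near_quasigeodesic[OF X detours L C] by blast
  obtain E where E: "0 \<le> E" "\<And>v f x. quasigeodesic_path L C X v f \<Longrightarrow> 0 \<le> x \<Longrightarrow> x \<le> v \<Longrightarrow>
      dist (f 0) (f x) + dist (f x) (f v) \<le> dist (f 0) (f v) + E"
    using quasigeodesic_almost_additive[OF X detours L C] by blast
  define N where "N = \<delta> + 1 + D"
  define C' where "C' = 2 * C + 2 * N + 2 * E + L"
  have "\<exists>w h. quasigeodesic_path L C' (A \<union> B) w h \<and> h 0 = f 0 \<and> h w = g v'"
    if AB: "A \<subseteq> X" "B \<subseteq> X" and f: "quasigeodesic_path L C A v f"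
      and g: "quasigeodesic_path L C B v' g" and fg: "f v = g 0"
    for v f v' g A B
  proof -
    note fD = quasigeodesic_pathD[OF f] and gD = quasigeodesic_pathD[OF g]
    have fX: "quasigeodesic_path L C X v f" and gX: "quasigeodesic_path L C X v' g"
      using quasigeodesic_path_mono[of L C _ _ _ L C X] f g AB L by auto
    have pts: "f 0 \<in> X" "f v \<in> X" "g v' \<in> X" using fD(1,2) gD(1,2) AB by auto
    obtain S T T' where S: "geodesic_between X (f 0) (g v') S"
        and T: "geodesic_between X (f v) (f 0) T" "geodesic_between X (f v) (g v') T'"
        and T0: "geodesic_between X (f 0) (f v) T"
    proof -
      obtain T where T: "geodesic_between X (f 0) (f v) T"
        using X pts unfolding geodesic_metric_space_def by meson
      obtain S T' where "geodesic_between X (f 0) (g v') S" "geodesic_between X (f v) (g v') T'"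
        using X pts unfolding geodesic_metric_space_def by meson
      then show thesis using that geodesic_between_commute T by blast
    qed
    have "\<exists>y\<in>f ` {0..v} \<union> g ` {0..v'}. dist r y < \<delta> + 1 + D" if "r \<in> S" for r
    proof -
      have "infdist r (T \<union> T') \<le> \<delta>"
        using hyp pts T S that unfolding delta_hyperbolic_def by blast
      moreover have "T \<union> T' \<noteq> {}" using geodesic_between_endpoints[OF T(1)] by blast
      ultimately obtain q where q: "q \<in> T \<union> T'" "dist r q < \<delta> + 1"
        using infdist_lessE[of r "T \<union> T'" "\<delta> + 1"] by auto
      have "\<exists>y\<in>f ` {0..v} \<union> g ` {0..v'}. dist q y < D"
      proof (cases "q \<in> T")
        case True
        then show ?thesis using D(2)[OF fX T0] by blast
      next
        case False
        then have "q \<in> T'" using q(1) by blast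
        then show ?thesis using D(2)[OF gX, of T' q] T(2) fg by auto
      qed
      then obtain y where y: "y \<in> f ` {0..v} \<union> g ` {0..v'}" "dist q y < D" by blast
      have "dist r y < \<delta> + 1 + D" using q(2) y(2) dist_triangle[of r y q] by linarith
      with y(1) show ?thesis by blast
    qed
    moreover have "f 0 \<in> f ` {0..v}" "g v' \<in> g ` {0..v'}" using fD(1) gD(1) by auto
    ultimately obtain r y z where "r \<in> S" "y \<in> f ` {0..v}" "z \<in> g ` {0..v'}"
        "dist r y < \<delta> + 1 + D" "dist r z < \<delta> + 1 + D"
      using geodesic_covered_meets_both[OF S, of "f ` {0..v}" "g ` {0..v'}" "\<delta> + 1 + D"] by metis
    then obtain s t where r: "r \<in> S" "dist r (f s) < N" "dist r (g t) < N"
      and s: "0 \<le> s" "s \<le> v" and t: "0 \<le> t" "t \<le> v'"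
      unfolding N_def by auto
    have jump: "dist (f s) (g t) \<le> 2 * N"
      using r dist_triangle3[of "f s" "g t" r] by simp
    have far: "dist (f x) (f s) + dist (g t) (g y) \<le> dist (f x) (g y) + 2 * N + 2 * E"
      if "0 \<le> x" "x \<le> s" "t \<le> y" "y \<le> v'" for x y
    proof -
      have "dist (f 0) (f x) + dist (f x) (f s) \<le> dist (f 0) (f s) + E"
        using E(2)[OF quasigeodesic_path_restrict[OF fX order_refl s], of x] that by simp
      moreover have "dist (g t) (g y) + dist (g y) (g v') \<le> dist (g t) (g v') + E"
        using E(2)[OF quasigeodesic_path_restrict[OF gX t order_refl], of "y - t"] that by simp
      moreover have "dist (f 0) r + dist r (g v') = dist (f 0) (g v')"
        using geodesic_between_additive[OF S r(1)] .
      moreover have "dist (f 0) (f s) \<le> dist (f 0) r + N"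
        using dist_triangle[of "f 0" "f s" r] r(2) by simp
      moreover have "dist (g t) (g v') \<le> dist r (g v') + N"
        using dist_triangle3[of "g t" "g v'" r] r(3) by simp
      moreover have "dist (f 0) (g v') \<le> dist (f 0) (f x) + dist (f x) (g y) + dist (g y) (g v')"
        using dist_triangle[of "f 0" "g v'" "f x"] dist_triangle[of "f x" "g v'" "g y"] by simp
      ultimately show ?thesis by linarith
    qed
    \<comment> \<open>The jump takes one unit of the parameter, spent waiting at \<open>f s\<close>; without it \<open>h\<close> would not
      reach \<open>g v'\<close> if \<open>t = v'\<close>.\<close>
    define h where "h x = (if x < s + 1 then f (min x s) else g (t + (x - s - 1)))" for x
    define w where "w = s + 1 + (v' - t)"
    have across: "inverse L * \<bar>x - y\<bar> - C' \<le> dist (h x) (h y) \<and> dist (h x) (h y) \<le> L * \<bar>x - y\<bar> + C'"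
      if "0 \<le> x" "x < s + 1" "s + 1 \<le> y" "y \<le> w" for x y
    proof -
      define x' where "x' = min x s"
      define y' where "y' = t + (y - s - 1)"
      have h: "h x = f x'" "h y = g y'" using that by (auto simp: h_def x'_def y'_def)
      have x': "0 \<le> x'" "x' \<le> s" and y': "t \<le> y'" "y' \<le> v'"
        using that s by (auto simp: x'_def y'_def w_def)
      have a: "\<bar>x' - s\<bar> + \<bar>t - y'\<bar> \<le> \<bar>x - y\<bar>" "\<bar>x - y\<bar> \<le> \<bar>x' - s\<bar> + \<bar>t - y'\<bar> + 1"
        using that by (auto simp: x'_def y'_def)
      have "inverse L \<le> L" using L by (meson inverse_le_1_iff order_trans)
      have "inverse L * \<bar>x - y\<bar> \<le> inverse L * (\<bar>x' - s\<bar> + \<bar>t - y'\<bar> + 1)"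
        using a(2) L by (intro mult_left_mono) auto
      then have "inverse L * \<bar>x - y\<bar> \<le> inverse L * \<bar>x' - s\<bar> + inverse L * \<bar>t - y'\<bar> + inverse L"
        by (simp add: algebra_simps)
      moreover have "inverse L * \<bar>x' - s\<bar> - C \<le> dist (f x') (f s)"
          "inverse L * \<bar>t - y'\<bar> - C \<le> dist (g t) (g y')"
        using fD(3)[of x' s] gD(3)[of t y'] x' y' s t by auto
      ultimately have lower: "inverse L * \<bar>x - y\<bar> - C' \<le> dist (h x) (h y)"
        using far[OF x' y'] \<open>inverse L \<le> L\<close> unfolding h C'_def by linarith
      have "L * (\<bar>x' - s\<bar> + \<bar>t - y'\<bar>) \<le> L * \<bar>x - y\<bar>"
        using a(1) L by (intro mult_left_mono) auto
      then have "L * \<bar>x' - s\<bar> + L * \<bar>t - y'\<bar> \<le> L * \<bar>x - y\<bar>"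
        by (simp add: algebra_simps)
      moreover have "dist (f x') (f s) \<le> L * \<bar>x' - s\<bar> + C" "dist (g t) (g y') \<le> L * \<bar>t - y'\<bar> + C"
        using fD(4)[of x' s] gD(4)[of t y'] x' y' s t by auto
      moreover have "dist (f x') (g y') \<le> dist (f x') (f s) + dist (f s) (g t) + dist (g t) (g y')"
        using dist_triangle[of "f x'" "g y'" "f s"] dist_triangle[of "f s" "g y'" "g t"] by simp
      ultimately have "dist (h x) (h y) \<le> L * \<bar>x - y\<bar> + C'"
        using jump E(1) L unfolding h C'_def by linarith
      with lower show ?thesis ..
    qed
    have "quasigeodesic_path L C' (A \<union> B) w h"
      unfolding quasigeodesic_path_def
    proof (intro conjI[of "0 \<le> w"] conjI[of "h ` {0..w} \<subseteq> A \<union> B"] ballI)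
      show "0 \<le> w" using s t by (simp add: w_def)
      show "h ` {0..w} \<subseteq> A \<union> B"
        using fD(2) gD(2) s t by (auto simp: h_def w_def)
    next
      fix x y assume xy: "x \<in> {0..w}" "y \<in> {0..w}"
      consider "x < s + 1" "s + 1 \<le> y" | "y < s + 1" "s + 1 \<le> x" | "x < s + 1" "y < s + 1"
        | "s + 1 \<le> x" "s + 1 \<le> y" by linarith
      then show "inverse L * \<bar>x - y\<bar> - C' \<le> dist (h x) (h y) \<and>
          dist (h x) (h y) \<le> L * \<bar>x - y\<bar> + C'"
      proof cases
        case 1
        then show ?thesis using across[of x y] xy by simp
      next
        case 2
        then show ?thesis
          using across[of y x] xy by (simp add: dist_commute abs_minus_commute)
      next
        case 3
        have "\<bar>min x s - min y s\<bar> \<le> \<bar>x - y\<bar>" "\<bar>x - y\<bar> \<le> \<bar>min x s - min y s\<bar> + 1"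
          using 3 by linarith+
        then have "L * \<bar>min x s - min y s\<bar> \<le> L * \<bar>x - y\<bar>"
            "inverse L * \<bar>x - y\<bar> \<le> inverse L * (\<bar>min x s - min y s\<bar> + 1)"
          using L by (auto intro!: mult_left_mono)
        moreover have "inverse L * (\<bar>min x s - min y s\<bar> + 1) =
            inverse L * \<bar>min x s - min y s\<bar> + inverse L"
          by (simp add: distrib_left)
        moreover have "inverse L \<le> L" using L by (meson inverse_le_1_iff order_trans)
        moreover have "inverse L * \<bar>min x s - min y s\<bar> - C \<le> dist (h x) (h y)"
            "dist (h x) (h y) \<le> L * \<bar>min x s - min y s\<bar> + C"
          using fD(3,4)[of "min x s" "min y s"] xy s 3 by (auto simp: h_def)
        ultimately show ?thesis
          using C E(1) D(1) \<open>0 \<le> \<delta>\<close> L unfolding C'_def N_def by argo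
      next
        case 4
        have "t + (x - s - 1) - (t + (y - s - 1)) = x - y" by simp
        then have "inverse L * \<bar>x - y\<bar> - C \<le> dist (h x) (h y)"
            "dist (h x) (h y) \<le> L * \<bar>x - y\<bar> + C"
          using gD(3,4)[of "t + (x - s - 1)" "t + (y - s - 1)"] xy t 4
          by (auto simp: h_def w_def)
        then show ?thesis
          using C E(1) D(1) \<open>0 \<le> \<delta>\<close> L unfolding C'_def N_def by argo
      qed
    qed
    moreover have "h 0 = f 0" "h w = g v'" using s t by (auto simp: h_def w_def)
    ultimately show ?thesis by blast
  qed
  moreover have "C \<le> C'" using C E(1) D(1) \<open>0 \<le> \<delta>\<close> L by (simp add: C'_def N_def)
  ultimately show thesis by (intro that[of C'])
qed

lemma union_quasigeodesic_if_hyperbolic: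
  fixes X :: "'a::metric_space set"
  assumes X: "geodesic_metric_space X" and hyp: "delta_hyperbolic \<delta> X" and "0 \<le> \<delta>"
    and L: "1 \<le> L" and C: "0 \<le> C"
  shows "\<exists>C'\<ge>C. \<forall>A B. A \<subseteq> X \<longrightarrow> B \<subseteq> X \<longrightarrow> quasigeodesic_subspace L C A \<longrightarrow>
    quasigeodesic_subspace L C B \<longrightarrow> A \<inter> B \<noteq> {} \<longrightarrow> quasigeodesic_subspace L C' (A \<union> B)"
proof -
  obtain C' where C': "C \<le> C'" "\<And>v f v' g A B. A \<subseteq> X \<Longrightarrow> B \<subseteq> X \<Longrightarrow>
      quasigeodesic_path L C A v f \<Longrightarrow> quasigeodesic_path L C B v' g \<Longrightarrow> f v = g 0 \<Longrightarrow>
      \<exists>w h. quasigeodesic_path L C' (A \<union> B) w h \<and> h 0 = f 0 \<and> h w = g v'"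
    using quasigeodesic_join[OF assms] by blast
  have join: "\<exists>w h. quasigeodesic_path L C' (A \<union> B) w h \<and> h 0 = a \<and> h w = b"
    if "A \<subseteq> X" "B \<subseteq> X" "quasigeodesic_subspace L C A" "quasigeodesic_subspace L C B"
      "c \<in> A" "c \<in> B" "a \<in> A" "b \<in> B" for A B a b c
  proof -
    obtain v f v' g where "quasigeodesic_path L C A v f" "f 0 = a" "f v = c"
        "quasigeodesic_path L C B v' g" "g 0 = c" "g v' = b"
      using \<open>quasigeodesic_subspace L C A\<close> \<open>quasigeodesic_subspace L C B\<close>
        \<open>a \<in> A\<close> \<open>c \<in> A\<close> \<open>c \<in> B\<close> \<open>b \<in> B\<close> unfolding quasigeodesic_subspace_path by meson
    then show ?thesis using C'(2)[OF \<open>A \<subseteq> X\<close> \<open>B \<subseteq> X\<close>] by metis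
  qed
  have "quasigeodesic_subspace L C' (A \<union> B)"
    if AB: "A \<subseteq> X" "B \<subseteq> X" "quasigeodesic_subspace L C A" "quasigeodesic_subspace L C B"
      "A \<inter> B \<noteq> {}" for A B
    unfolding quasigeodesic_subspace_path
  proof (intro ballI)
    fix a b assume ab: "a \<in> A \<union> B" "b \<in> A \<union> B"
    obtain c where c: "c \<in> A" "c \<in> B" using AB(5) by blast
    have inside: "\<exists>w h. quasigeodesic_path L C' (A \<union> B) w h \<and> h 0 = a \<and> h w = b"
      if A': "quasigeodesic_subspace L C A'" "a \<in> A'" "b \<in> A'" "A' \<subseteq> A \<union> B" for A'
    proof -
      obtain v f where "quasigeodesic_path L C A' v f" "f 0 = a" "f v = b"
        using A' unfolding quasigeodesic_subspace_path by meson
      then show ?thesis using quasigeodesic_path_mono[OF _ _ order_refl C'(1) A'(4)] L by fastforce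
    qed
    from ab consider "a \<in> A" "b \<in> A" | "a \<in> B" "b \<in> B" | "a \<in> A" "b \<in> B" | "a \<in> B" "b \<in> A"
      by blast
    then show "\<exists>w h. quasigeodesic_path L C' (A \<union> B) w h \<and> h 0 = a \<and> h w = b"
    proof cases
      case 1 then show ?thesis using inside[OF AB(3)] by simp
    next
      case 2 then show ?thesis using inside[OF AB(4)] by simp
    next
      case 3 then show ?thesis using join[OF AB(1-4) c] by simp
    next
      case 4 then show ?thesis using join[OF AB(2,1,4,3) c(2,1)] by (simp add: Un_commute)
    qed
  qed
  then show ?thesis using C'(1) by blast
qed


section \<open>Hyperbolicity from unions of two geodesics\<close>

definition quasigeodesic_wedges :: "real \<Rightarrow> real \<Rightarrow> 'a::metric_space set \<Rightarrow> bool" where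
  "quasigeodesic_wedges L C X \<longleftrightarrow> (\<forall>u g u' g'. geodesic_path X u g \<longrightarrow> geodesic_path X u' g' \<longrightarrow>
     g 0 = g' 0 \<longrightarrow> quasigeodesic_subspace L C (g ` {0..u} \<union> g' ` {0..u'}))"

text \<open>
  A quasigeodesic between the ends of the two geodesics that stays in their union has to jump
  from one to the other. Its length is at most linear in the distance \<open>D\<close> of the ends, so the jump
  takes place near them: after having been close for the last time, the geodesics diverge at a
  definite linear rate.
\<close>

lemma wedge_jump_near_ends:
  assumes wedges: "quasigeodesic_wedges L C X" and L: "1 \<le> L"
    and g: "geodesic_path X u g" and g': "geodesic_path X u' g'" and "g 0 = g' 0"
    and D: "dist (g u) (g' u') \<le> D"
  obtains s s' where "0 \<le> s" "s \<le> u" "0 \<le> s'" "s' \<le> u'" "dist (g s) (g' s') \<le> L + C"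
    "u - s \<le> L * (L * (D + C)) + C" "u' - s' \<le> L * (L * (D + C)) + C"
proof -
  note gD = geodesic_pathD[OF g] and g'D = geodesic_pathD[OF g']
  define P where "P = g ` {0..u}"
  define Q where "Q = g' ` {0..u'}"
  have ends: "g u \<in> P" "g' u' \<in> Q" using gD(1) g'D(1) by (auto simp: P_def Q_def)
  have "quasigeodesic_subspace L C (P \<union> Q)"
    using wedges g g' \<open>g 0 = g' 0\<close> unfolding quasigeodesic_wedges_def P_def Q_def by blast
  moreover have "g u \<in> P \<union> Q" "g' u' \<in> P \<union> Q" using ends by auto
  ultimately obtain v f where f: "quasigeodesic_path L C (P \<union> Q) v f" "f 0 = g u" "f v = g' u'"
    unfolding quasigeodesic_subspace_path by meson
  note fD = quasigeodesic_pathD[OF f(1)]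
  have v: "v \<le> L * (D + C)"
    using quasigeodesic_path_parameter_bound[OF f(1), of 0 v D] f D L fD(1) by simp
  obtain x x' where x: "0 \<le> x" "x \<le> v" "0 \<le> x'" "x' \<le> v" "\<bar>x - x'\<bar> \<le> 1" "f x \<in> P" "f x' \<in> Q"
  proof -
    define n where "n = (LEAST n. f (min (real n) v) \<in> Q)"
    have "v \<le> real (nat \<lceil>v\<rceil>)" by linarith
    then have "f (min (real (nat \<lceil>v\<rceil>)) v) \<in> Q" using ends f by simp
    then have n: "f (min (real n) v) \<in> Q" unfolding n_def by (rule LeastI)
    show thesis
    proof (cases n)
      case 0
      then show thesis using that[of 0 0] n ends f fD(1) by simp
    next
      case (Suc m)
      then have "f (min (real m) v) \<notin> Q"
        using not_less_Least[of m "\<lambda>n. f (min (real n) v) \<in> Q"] unfolding n_def by auto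
      then have "f (min (real m) v) \<in> P" using fD(1) fD(2)[of "min (real m) v"] by auto
      then show thesis
        using that[of "min (real m) v" "min (real n) v"] n Suc fD(1) by simp
    qed
  qed
  obtain s s' where s: "0 \<le> s" "s \<le> u" "f x = g s" and s': "0 \<le> s'" "s' \<le> u'" "f x' = g' s'"
    using x(6,7) unfolding P_def Q_def by auto
  have scale: "L * z \<le> L * (L * (D + C))" if "z \<le> v" for z
    using that v L by (intro mult_left_mono) auto
  have "L * \<bar>x - x'\<bar> \<le> L * 1" using x L by (intro mult_left_mono) auto
  then have "dist (g s) (g' s') \<le> L + C" using fD(4)[of x x'] x s s' by simp
  moreover have "u - s \<le> L * (L * (D + C)) + C"
  proof -
    have "u - s = dist (f 0) (f x)" using f s gD(1) gD(3)[of u s] by simp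
    also have "\<dots> \<le> L * \<bar>0 - x\<bar> + C" using fD(1) fD(4)[of 0 x] x by simp
    finally show ?thesis using scale[of "\<bar>0 - x\<bar>"] x by simp
  qed
  moreover have "u' - s' \<le> L * (L * (D + C)) + C"
  proof -
    have "u' - s' = dist (f v) (f x')" using f s' g'D(1) g'D(3)[of u' s'] by simp
    also have "\<dots> \<le> L * \<bar>v - x'\<bar> + C" using fD(1) fD(4)[of v x'] x by simp
    finally show ?thesis using scale[of "\<bar>v - x'\<bar>"] x by simp
  qed
  ultimately show thesis using that s s' by blast
qed

text \<open>
  The bound \<open>F\<close> does not depend on the distance \<open>D\<close> of the ends, only the length \<open>M\<close> that has to
  be cut off does; this is what keeps the bound fixed under the repeated halving below. A pair of
  close points is moved towards the start by stepping back one unit and looking for a jump near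
  the new ends; each move lowers both parameters by at least 1 and at most the \<open>J\<close> of the
  proof, so at some pair one parameter is within \<open>J\<close> of \<open>t\<close>; the other is close to it.
\<close>

lemma wedge_fellow_travel:
  fixes X :: "'a::metric_space set"
  assumes wedges: "quasigeodesic_wedges L C X" and L: "1 \<le> L" and C: "0 \<le> C"
  obtains F where "0 \<le> F" "\<And>D. 0 \<le> D \<Longrightarrow> \<exists>M\<ge>0. \<forall>u g u' g' t. geodesic_path X u g \<longrightarrow>
    geodesic_path X u' g' \<longrightarrow> g 0 = g' 0 \<longrightarrow> dist (g u) (g' u') \<le> D \<longrightarrow>
    0 \<le> t \<longrightarrow> t \<le> u - M \<longrightarrow> t \<le> u' - M \<longrightarrow> dist (g t) (g' t) \<le> F"
proof -
  define K where "K D = L * (L * (D + C)) + C" for D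
  have K: "0 \<le> K D" if "0 \<le> D" for D using that L C by (simp add: K_def)
  define J where "J = K (L + C + 2) + 1"
  have J: "1 \<le> J" using K[of "L + C + 2"] L C by (simp add: J_def)
  define F where "F = 2 * (J + (L + C)) + (L + C)"
  have travel: "dist (g t) (g' t) \<le> F"
    if g: "geodesic_path X u g" and g': "geodesic_path X u' g'" and start: "g 0 = g' 0"
      and "0 \<le> t" "t \<le> s" "s \<le> u" "t \<le> s'" "s' \<le> u'" "dist (g s) (g' s') \<le> L + C" "s \<le> t + real n"
    for u g u' g' t s s' n
    using that(4-)
  proof (induction n arbitrary: s s')
    note gD = geodesic_pathD[OF g] and g'D = geodesic_pathD[OF g']
    have near: "dist (g t) (g' t) \<le> F"
      if "0 \<le> t" "t \<le> s" "s \<le> u" "t \<le> s'" "s' \<le> u'" "dist (g s) (g' s') \<le> L + C"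
        "s - t \<le> J \<or> s' - t \<le> J" for s s'
    proof -
      have d: "dist (g t) (g s) = s - t" "dist (g' t) (g' s') = s' - t"
        using gD(3)[of t s] g'D(3)[of t s'] that by auto
      have "dist (g 0) (g s) = s" "dist (g 0) (g' s') = s'"
        using gD(3)[of 0 s] g'D(3)[of 0 s'] that start by auto
      then have "\<bar>s - s'\<bar> \<le> L + C"
        using that(6) dist_triangle[of "g 0" "g s" "g' s'"] dist_triangle[of "g 0" "g' s'" "g s"]
        by (simp add: dist_commute)
      then have "s - t \<le> J + (L + C)" "s' - t \<le> J + (L + C)" using that(7) L C by linarith+
      moreover have "dist (g t) (g' t) \<le> dist (g t) (g s) + dist (g s) (g' s') + dist (g' t) (g' s')"
        using dist_triangle[of "g t" "g' t" "g s"] dist_triangle2[of "g s" "g' t" "g' s'"] by linarith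
      moreover have "2 * (J + (L + C)) + (L + C) = (J + (L + C)) + (L + C) + (J + (L + C))" by simp
      ultimately show ?thesis using d that(6) unfolding F_def by linarith
    qed
    {
      case 0
      then show ?case using near[of s s'] J by simp
    next
      case (Suc n)
      show ?case
      proof (cases "s - t \<le> J \<or> s' - t \<le> J")
        case True
        then show ?thesis using near Suc.prems by blast
      next
        case False
        then have s: "0 \<le> s - 1" "0 \<le> s' - 1" using J Suc.prems by auto
        have "dist (g (s - 1)) (g s) = 1" "dist (g' (s' - 1)) (g' s') = 1"
          using gD(3)[of "s - 1" s] g'D(3)[of "s' - 1" s'] s Suc.prems by auto
        then have "dist (g (s - 1)) (g' (s' - 1)) \<le> L + C + 2"
          using dist_triangle[of "g (s - 1)" "g' (s' - 1)" "g s"]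
            dist_triangle2[of "g s" "g' (s' - 1)" "g' s'"] Suc.prems by linarith
        moreover have g1: "geodesic_path X (s - 1) g" and g1': "geodesic_path X (s' - 1) g'"
          using geodesic_path_restrict[OF g] geodesic_path_restrict[OF g'] s Suc.prems by auto
        ultimately obtain r r' where r: "0 \<le> r" "r \<le> s - 1" "0 \<le> r'" "r' \<le> s' - 1"
            "dist (g r) (g' r') \<le> L + C"
            "s - 1 - r \<le> K (L + C + 2)" "s' - 1 - r' \<le> K (L + C + 2)"
          using wedge_jump_near_ends[OF wedges L g1 g1' start] unfolding K_def by blast
        have "t \<le> r" "t \<le> r'" using False r unfolding J_def by auto
        then show ?thesis using Suc.IH[of r r'] r Suc.prems by simp
      qed
    }
  qed
  have "\<exists>M\<ge>0. \<forall>u g u' g' t. geodesic_path X u g \<longrightarrow> geodesic_path X u' g' \<longrightarrow> g 0 = g' 0 \<longrightarrow>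
      dist (g u) (g' u') \<le> D \<longrightarrow> 0 \<le> t \<longrightarrow> t \<le> u - M \<longrightarrow> t \<le> u' - M \<longrightarrow> dist (g t) (g' t) \<le> F"
    if "0 \<le> D" for D
  proof (intro exI[of _ "K D"] conjI allI impI)
    show "0 \<le> K D" using K[OF that] .
    fix u g u' g' t
    assume g: "geodesic_path X u g" and g': "geodesic_path X u' g'" and start: "g 0 = g' 0"
      and "dist (g u) (g' u') \<le> D" and t: "0 \<le> t" "t \<le> u - K D" "t \<le> u' - K D"
    then obtain s s' where s: "0 \<le> s" "s \<le> u" "0 \<le> s'" "s' \<le> u'" "dist (g s) (g' s') \<le> L + C"
        "u - s \<le> K D" "u' - s' \<le> K D"
      using wedge_jump_near_ends[OF wedges L g g' start] unfolding K_def by blast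
    obtain n where "s - t \<le> real n" using real_arch_simple by blast
    then show "dist (g t) (g' t) \<le> F"
      using travel[OF g g' start t(1), of s s' n] s t by simp
  qed
  moreover have "0 \<le> F" using J L C by (simp add: F_def)
  ultimately show thesis using that by blast
qed

text \<open>
  Join \<open>p\<close> by geodesics to the vertices of a detour. The geodesics to its two ends fellow-travel
  the one to its midpoint, and so each other, up to a distance from \<open>p\<close> that drops by a constant
  with each doubling of the number of steps. The two halves of a geodesic through \<open>p\<close> do not
  fellow-travel at all.
\<close>

lemma exponential_detours_if_wedges:
  fixes X :: "'a::metric_space set"
  assumes X: "geodesic_metric_space X" and wedges: "quasigeodesic_wedges L C X"
    and L: "1 \<le> L" and C: "0 \<le> C"
  shows "exponential_detours X"
  unfolding exponential_detours_def
proof (intro allI impI)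
  fix \<sigma> :: real assume "0 \<le> \<sigma>"
  obtain F where F: "0 \<le> F" "\<And>D. 0 \<le> D \<Longrightarrow> \<exists>M\<ge>0. \<forall>u g u' g' t. geodesic_path X u g \<longrightarrow>
      geodesic_path X u' g' \<longrightarrow> g 0 = g' 0 \<longrightarrow> dist (g u) (g' u') \<le> D \<longrightarrow>
      0 \<le> t \<longrightarrow> t \<le> u - M \<longrightarrow> t \<le> u' - M \<longrightarrow> dist (g t) (g' t) \<le> F"
    using wedge_fellow_travel[OF wedges L C] by blast
  obtain M0 where M0: "0 \<le> M0" "\<And>u g u' g' t. geodesic_path X u g \<Longrightarrow> geodesic_path X u' g' \<Longrightarrow>
      g 0 = g' 0 \<Longrightarrow> dist (g u) (g' u') \<le> \<sigma> \<Longrightarrow> 0 \<le> t \<Longrightarrow> t \<le> u - M0 \<Longrightarrow> t \<le> u' - M0 \<Longrightarrow>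
      dist (g t) (g' t) \<le> F"
    using F(2)[OF \<open>0 \<le> \<sigma>\<close>] by blast
  obtain M1 where M1: "0 \<le> M1" "\<And>u g u' g' t. geodesic_path X u g \<Longrightarrow> geodesic_path X u' g' \<Longrightarrow>
      g 0 = g' 0 \<Longrightarrow> dist (g u) (g' u') \<le> 2 * F \<Longrightarrow> 0 \<le> t \<Longrightarrow> t \<le> u - M1 \<Longrightarrow> t \<le> u' - M1 \<Longrightarrow>
      dist (g t) (g' t) \<le> F"
    using F(2)[of "2 * F"] F(1) by auto
  have close: "dist (g t) (g' t) \<le> F"
    if "geodesic_path X u g" "geodesic_path X u' g'" "g 0 = p" "g' 0 = p"
      "(g u, g' u') \<in> step_avoiding X \<sigma> p R ^^ (2 ^ k)" "0 \<le> t" "t \<le> R - M0 - real k * M1"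
    for k R p u g u' g' t
    using that
  proof (induction k arbitrary: u g u' g' t)
    case 0
    then have "dist (g u) (g' u') \<le> \<sigma>" "R \<le> dist (g 0) (g u)" "R \<le> dist (g' 0) (g' u')"
      by (auto simp: step_avoiding_def)
    moreover have "dist (g 0) (g u) = u" "dist (g' 0) (g' u') = u'"
      using geodesic_pathD(1)[OF 0(1)] geodesic_pathD(3)[OF 0(1), of 0 u]
        geodesic_pathD(1)[OF 0(2)] geodesic_pathD(3)[OF 0(2), of 0 u'] by auto
    ultimately show ?case using 0 by (intro M0(2)[of u g u' g' t]) auto
  next
    case (Suc k)
    obtain m where m: "(g u, m) \<in> step_avoiding X \<sigma> p R ^^ (2 ^ k)"
        "(m, g' u') \<in> step_avoiding X \<sigma> p R ^^ (2 ^ k)"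
      using Suc.prems(5) by (rule relpow_double_stepE)
    have far: "m \<in> X" "R \<le> dist p (g u)" "R \<le> dist p (g' u')"
      using relpow_step_avoiding_ends[OF m(1)] relpow_step_avoiding_ends[OF m(2)] by auto
    have "p \<in> X" using geodesic_pathD(1,2)[OF Suc.prems(1)] Suc.prems(3) by auto
    then obtain h where h: "geodesic_path X (dist p m) h" "h 0 = p" "h (dist p m) = m"
      using geodesic_path_exists[OF X _ far(1)] by blast
    define T where "T = R - M0 - real k * M1"
    have T: "0 \<le> T" "t \<le> T - M1" "T \<le> R"
      using Suc.prems(6,7) M0(1) M1(1) by (auto simp: T_def algebra_simps)
    have "dist (g T) (h T) \<le> F"
      using Suc.IH[OF Suc.prems(1) h(1) Suc.prems(3) h(2), of T] m(1) h(3) T by (simp add: T_def)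
    moreover have "dist (h T) (g' T) \<le> F"
      using Suc.IH[OF h(1) Suc.prems(2) h(2) Suc.prems(4), of T] m(2) h(3) T by (simp add: T_def)
    ultimately have "dist (g T) (g' T) \<le> 2 * F"
      using dist_triangle[of "g T" "g' T" "h T"] by simp
    moreover have "dist p (g u) = u" "dist p (g' u') = u'"
      using geodesic_pathD(1)[OF Suc.prems(1)] geodesic_pathD(3)[OF Suc.prems(1), of 0 u]
        geodesic_pathD(1)[OF Suc.prems(2)] geodesic_pathD(3)[OF Suc.prems(2), of 0 u']
        Suc.prems(3,4) by auto
    then have "geodesic_path X T g" "geodesic_path X T g'"
      using geodesic_path_restrict[OF Suc.prems(1), of T] geodesic_path_restrict[OF Suc.prems(2), of T]
        T far by auto
    ultimately show ?case
      using M1(2)[of T g T g' t] Suc.prems T by simp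
  qed
  show "\<exists>M>0. \<forall>k R b c S p. geodesic_between X b c S \<longrightarrow> p \<in> S \<longrightarrow>
      (b, c) \<in> step_avoiding X \<sigma> p R ^^ (2 ^ k) \<longrightarrow> R \<le> M * (real k + 1)"
  proof (intro exI[of _ "M0 + M1 + F + 1"] conjI allI impI)
    show "0 < M0 + M1 + F + 1" using M0(1) M1(1) F(1) by simp
    fix k R b c S p
    assume S: "geodesic_between X b c S" and "p \<in> S"
      and detour: "(b, c) \<in> step_avoiding X \<sigma> p R ^^ (2 ^ k)"
    obtain u g where g: "geodesic_path X u g" "g 0 = b" "g u = c" "S = g ` {0..u}"
      using S unfolding geodesic_between_path by blast
    note gD = geodesic_pathD[OF g(1)]
    obtain w where w: "0 \<le> w" "w \<le> u" "p = g w" using \<open>p \<in> S\<close> g(4) by auto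
    have backward: "geodesic_path X w (\<lambda>x. g (w - x))"
      and forward: "geodesic_path X (u - w) (\<lambda>x. g (w + x))"
      using gD w by (auto simp: geodesic_path_def)
    have "R \<le> M0 + real k * M1 + F"
    proof (rule ccontr)
      define t where "t = R - M0 - real k * M1"
      assume "\<not> R \<le> M0 + real k * M1 + F"
      then have t: "F < t" by (simp add: t_def)
      have "R \<le> dist p b" "R \<le> dist p c" using relpow_step_avoiding_ends[OF detour] by auto
      moreover have "dist p b = w" "dist p c = u - w"
        using gD(3)[of w 0] gD(3)[of w u] g(2,3) w by auto
      moreover have "0 \<le> real k * M1" using M1(1) by simp
      then have "t \<le> R" using M0(1) by (simp add: t_def)
      ultimately have "dist (g (w - t)) (g (w + t)) = 2 * t"
        using gD(3)[of "w - t" "w + t"] w t F(1) by simp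
      moreover have "dist (g (w - t)) (g (w + t)) \<le> F"
        using close[OF backward forward, where p = p and R = R and k = k and t = t]
          g w detour t F(1) by (simp add: t_def)
      ultimately show False using t F(1) by simp
    qed
    also have "\<dots> \<le> (M0 + M1 + F + 1) * (real k + 1)"
      using M0(1) M1(1) F(1) by (simp add: algebra_simps)
    finally show "R \<le> (M0 + M1 + F + 1) * (real k + 1)" .
  qed
qed

text \<open>Two sides of a triangle form a wedge, which contains a quasigeodesic between the ends of the
  third side; the third side stays close to it.\<close>

lemma hyperbolic_if_wedges:
  fixes X :: "'a::metric_space set"
  assumes X: "geodesic_metric_space X" and "quasigeodesic_wedges L C X" and "0 < L"
  shows "\<exists>\<delta>\<ge>0. delta_hyperbolic \<delta> X"
proof -
  define L' where "L' = max 1 L"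
  define C' where "C' = max 0 C"
  have L': "1 \<le> L'" "L \<le> L'" and C': "0 \<le> C'" "C \<le> C'" by (auto simp: L'_def C'_def)
  have wedges: "quasigeodesic_wedges L' C' X"
    using assms(2) quasigeodesic_subspace_mono[OF _ \<open>0 < L\<close> L'(2) C'(2)]
    unfolding quasigeodesic_wedges_def by blast
  have detours: "exponential_detours X"
    using exponential_detours_if_wedges[OF X wedges L'(1) C'(1)] .
  obtain D where D: "0 < D" "\<And>v f S p. quasigeodesic_path L' C' X v f \<Longrightarrow>
      geodesic_between X (f 0) (f v) S \<Longrightarrow> p \<in> S \<Longrightarrow> \<exists>x\<in>{0..v}. dist p (f x) < D"
    using geodesic_near_quasigeodesic[OF X detours L'(1) C'(1)] by blast
  have "infdist p (Sab \<union> Sac) \<le> D"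
    if ab: "geodesic_between X a b Sab" and bc: "geodesic_between X b c Sbc"
      and ac: "geodesic_between X a c Sac" and p: "p \<in> Sbc" for a b c Sab Sbc Sac p
  proof -
    obtain u g where g: "geodesic_path X u g" "g 0 = a" "g u = b" "Sab = g ` {0..u}"
      using ab unfolding geodesic_between_path by blast
    obtain u' g' where g': "geodesic_path X u' g'" "g' 0 = a" "g' u' = c" "Sac = g' ` {0..u'}"
      using ac unfolding geodesic_between_path by blast
    have "quasigeodesic_subspace L' C' (Sab \<union> Sac)"
      using wedges g g' unfolding quasigeodesic_wedges_def by simp
    moreover have "b \<in> Sab \<union> Sac" "c \<in> Sab \<union> Sac"
      using geodesic_between_endpoints[OF ab] geodesic_between_endpoints[OF ac] by auto
    ultimately obtain v f where f: "quasigeodesic_path L' C' (Sab \<union> Sac) v f" "f 0 = b" "f v = c"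
      unfolding quasigeodesic_subspace_path by meson
    have "Sab \<union> Sac \<subseteq> X"
      using geodesic_between_subset[OF ab] geodesic_between_subset[OF ac] by simp
    then have "quasigeodesic_path L' C' X v f"
      using quasigeodesic_path_mono[OF f(1) _ order_refl order_refl] L'(1) by simp
    then obtain x where x: "x \<in> {0..v}" "dist p (f x) < D" using D(2) bc p f(2,3) by blast
    have "f x \<in> Sab \<union> Sac" using quasigeodesic_pathD(2)[OF f(1)] x(1) by auto
    then show ?thesis using x(2) by (intro infdist_le2) auto
  qed
  then have "delta_hyperbolic D X" unfolding delta_hyperbolic_def by blast
  then show ?thesis using D(1) less_imp_le by blast
qed

lemma wedges_if_unions:
  assumes unions: "\<And>A B. A \<subseteq> X \<Longrightarrow> B \<subseteq> X \<Longrightarrow> quasigeodesic_subspace 1 1 A \<Longrightarrow>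
    quasigeodesic_subspace 1 1 B \<Longrightarrow> A \<inter> B \<noteq> {} \<Longrightarrow> quasigeodesic_subspace L C (A \<union> B)"
  shows "quasigeodesic_wedges L C X"
  unfolding quasigeodesic_wedges_def
proof (intro allI impI)
  fix u g u' g'
  assume g: "geodesic_path X u g" and g': "geodesic_path X u' g'" and "g 0 = g' 0"
  have "g 0 \<in> g ` {0..u}" "g' 0 \<in> g' ` {0..u'}"
    using geodesic_pathD(1)[OF g] geodesic_pathD(1)[OF g'] by auto
  then have "g ` {0..u} \<inter> g' ` {0..u'} \<noteq> {}" using \<open>g 0 = g' 0\<close> by auto
  then show "quasigeodesic_subspace L C (g ` {0..u} \<union> g' ` {0..u'})"
    using g g' quasigeodesic_subspace_geodesic[OF g, of 1] quasigeodesic_subspace_geodesic[OF g', of 1]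
    by (intro unions) (auto simp: geodesic_path_def)
qed


section \<open>The three equivalent conditions\<close>

theorem theorem2p2:
  fixes X :: "'a::metric_space set"
  assumes "geodesic_metric_space X"
  shows
    "((\<forall>C>0. \<exists>C'::real. \<forall>A B. A \<subseteq> X \<longrightarrow> B \<subseteq> X \<longrightarrow>
          quasigeodesic_subspace 1 C A \<longrightarrow> quasigeodesic_subspace 1 C B \<longrightarrow> A \<inter> B \<noteq> {} \<longrightarrow>
          quasigeodesic_subspace 1 C' (A \<union> B))
      \<longleftrightarrow>
      (\<forall>L>0. \<forall>C>0. \<exists>L'>0. \<exists>C'>0. \<forall>A B. A \<subseteq> X \<longrightarrow> B \<subseteq> X \<longrightarrow>
          quasigeodesic_subspace L C A \<longrightarrow> quasigeodesic_subspace L C B \<longrightarrow> A \<inter> B \<noteq> {} \<longrightarrow>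
          quasigeodesic_subspace L' C' (A \<union> B)))
     \<and>
     ((\<forall>L>0. \<forall>C>0. \<exists>L'>0. \<exists>C'>0. \<forall>A B. A \<subseteq> X \<longrightarrow> B \<subseteq> X \<longrightarrow>
          quasigeodesic_subspace L C A \<longrightarrow> quasigeodesic_subspace L C B \<longrightarrow> A \<inter> B \<noteq> {} \<longrightarrow>
          quasigeodesic_subspace L' C' (A \<union> B))
      \<longleftrightarrow>
      (\<exists>\<delta>\<ge>0. delta_hyperbolic \<delta> X))"
  (is "(?one \<longleftrightarrow> ?two) \<and> (?two \<longleftrightarrow> ?three)")
proof -
  have "?one \<Longrightarrow> ?three"
  proof -
    assume ?one
    then obtain C' where "\<And>A B. A \<subseteq> X \<Longrightarrow> B \<subseteq> X \<Longrightarrow> quasigeodesic_subspace 1 1 A \<Longrightarrow>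
        quasigeodesic_subspace 1 1 B \<Longrightarrow> A \<inter> B \<noteq> {} \<Longrightarrow> quasigeodesic_subspace 1 C' (A \<union> B)"
      by (meson zero_less_one)
    then have "quasigeodesic_wedges 1 C' X" by (rule wedges_if_unions)
    then show ?three using hyperbolic_if_wedges[OF assms] zero_less_one by blast
  qed
  moreover have "?two \<Longrightarrow> ?three"
  proof -
    assume ?two
    then obtain L' C' where "0 < L'" and "\<And>A B. A \<subseteq> X \<Longrightarrow> B \<subseteq> X \<Longrightarrow>
        quasigeodesic_subspace 1 1 A \<Longrightarrow> quasigeodesic_subspace 1 1 B \<Longrightarrow> A \<inter> B \<noteq> {} \<Longrightarrow>
        quasigeodesic_subspace L' C' (A \<union> B)"
      by (meson zero_less_one)
    then have "quasigeodesic_wedges L' C' X" by (intro wedges_if_unions)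
    then show ?three using hyperbolic_if_wedges[OF assms] \<open>0 < L'\<close> by blast
  qed
  moreover have "?three \<Longrightarrow> ?one"
  proof (intro allI impI)
    fix C :: real assume ?three and "0 < C"
    then obtain \<delta> where "0 \<le> \<delta>" "delta_hyperbolic \<delta> X" by blast
    then show "\<exists>C'. \<forall>A B. A \<subseteq> X \<longrightarrow> B \<subseteq> X \<longrightarrow> quasigeodesic_subspace 1 C A \<longrightarrow>
        quasigeodesic_subspace 1 C B \<longrightarrow> A \<inter> B \<noteq> {} \<longrightarrow> quasigeodesic_subspace 1 C' (A \<union> B)"
      using union_quasigeodesic_if_hyperbolic[OF assms, of \<delta> 1 C] \<open>0 < C\<close> by auto
  qed
  moreover have "?three \<Longrightarrow> ?two"
  proof (intro allI impI)
    fix L C :: real assume ?three and "0 < L" "0 < C"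
    then obtain \<delta> where "0 \<le> \<delta>" "delta_hyperbolic \<delta> X" by blast
    then obtain C' where C': "C \<le> C'" "\<And>A B. A \<subseteq> X \<Longrightarrow> B \<subseteq> X \<Longrightarrow>
        quasigeodesic_subspace (max 1 L) C A \<Longrightarrow> quasigeodesic_subspace (max 1 L) C B \<Longrightarrow>
        A \<inter> B \<noteq> {} \<Longrightarrow> quasigeodesic_subspace (max 1 L) C' (A \<union> B)"
      using union_quasigeodesic_if_hyperbolic[OF assms, of \<delta> "max 1 L" C] \<open>0 < C\<close> by auto
    have "quasigeodesic_subspace (max 1 L) C A" if "quasigeodesic_subspace L C A" for A :: "'a set"
      using quasigeodesic_subspace_mono[OF that \<open>0 < L\<close>] by simp
    then show "\<exists>L'>0. \<exists>C'>0. \<forall>A B. A \<subseteq> X \<longrightarrow> B \<subseteq> X \<longrightarrow> quasigeodesic_subspace L C A \<longrightarrow>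
        quasigeodesic_subspace L C B \<longrightarrow> A \<inter> B \<noteq> {} \<longrightarrow> quasigeodesic_subspace L' C' (A \<union> B)"
      using C' \<open>0 < C\<close> by (intro exI[of _ "max 1 L"] exI[of _ C'] conjI allI impI) auto
  qed
  ultimately show ?thesis by argo
qed

end
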